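(* (i) Assume that for any diagram $B\to A\leftarrow C$ in $\mathbf D$ a pullback in $\mathbf C$ can be found in finite time, for any object $U$ of $\mathbf C$ the set $\Sigma(U)$ can be determined in finite time, and for any cover $f$ the value $\deg f$ can be computed in finite time. Then Algorithm I terminates on every input cover. (ii) For every input cover $f$, the output $g$ of Algorithm I is a Galois closure of $f$.
   Context: Let $\mathbf C$ be a category and $\mathbf D$ a full subcategory of $\mathbf C$. For arrows $f,g$ of $\mathbf C$ with ${\rm cod}\,f={\rm cod}\,g$, ${\rm Hom}(g,f)$ denotes the collection of all arrows $h$ of $\mathbf C$ with $g=f\circ h$. Standing assumptions: (G1) every diagram $B\to A\leftarrow C$ in $\mathbf D$ has a pullback in $\mathbf C$. (G2) (I) pushouts exist in $\mathbf D$; (II) every arrow of $\mathbf D$ is epic; (III) every monic arrow of $\mathbf D$ is an isomorphism whose inverse is an arrow of $\mathbf D$. (G3) for every object $U$ of $\mathbf C$ there is a set $\Sigma(U)$ of arrows $i$ of $\mathbf C$ with ${\rm dom}\,i$ in $\mathbf D$ and ${\rm cod}\,i=U$ such that for every arrow $u$ of $\mathbf C$ with ${\rm dom}\,u$ in $\mathbf D$ and ${\rm cod}\,u=U$ there is exactly one $i\in\Sigma(U)$ with ${\rm Hom}(u,i)\neq\emptyset$. (G4) there is a function $\deg$ from the collection of arrows of $\mathbf C$ whose codomain lies in $\mathbf D$ to the positive integers such that (I) $\deg(g\circ f)=\deg g\cdot\deg f$ whenever $f,g,g\circ f$ all lie in this collection; (II) $\deg f=\sum_{i\in\Sigma({\rm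 dom}\,f)}\deg(f\circ i)$ for every such $f$; (III) if $B\xrightarrow{f}A\xleftarrow{g}C$ is a diagram in $\mathbf D$ with pullback $B\xleftarrow{p}U\xrightarrow{q}C$, then $\deg f=\deg q$ and $\deg g=\deg p$. A cover is an arrow of $\mathbf D$. For a cover $f$, ${\rm Aut}(f)$ is the set of isomorphisms in ${\rm Hom}(f,f)$; $f$ is Galois if $|{\rm Aut}(f)|=\deg f$. Write $f\sqsubseteq g$ if ${\rm cod}\,f={\rm cod}\,g$ and ${\rm Hom}(g,f)\neq\emptyset$. A cover $g$ is minimal with respect to a property $P$ if $g$ has $P$ and $g\sqsubseteq h$ for every cover $h$ with $P$ and $h\sqsubseteq g$. A Galois closure of a cover $f$ is a cover $g$ which is minimal with respect to the property "$g$ is Galois and $f\sqsubseteq g$". Algorithm I. Input: a cover $f:B\to A$. Initially set $g:C\to A$ to be $f$ and $n=1$. (1) If $n\ge\deg f-1$, output $g$; else go to (2). (2) Choose a pullback $B\xleftarrow{p}U\xrightarrow{q}C$ of $B\xrightarrow{f}A\xleftarrow{g}C$ and the set $\Sigma(U)$; go to (3). (3) If $\deg(q\circ i)=1$ for all $i\in\Sigma(U)$, output $g$; else go to (4). (4) Choose $i\in\Sigma(U)$ with $\deg(q\circ i)>1$; go to (5). (5) Replace $g$ by $g\circ q\circ i$ (so $C$ becomes ${\rm dom}\,i$), increase $n$ by one, and go back to (1). *)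

theory Defs
  imports Main "HOL-Library.Extended_Nat"
begin

text \<open>Composition is a total function on the arrow type; it is only meaningful
  on composable pairs. \<open>g \<cdot> f\<close> means first \<open>f\<close>, then \<open>g\<close>.\<close>

record ('o, 'a) cat =
  Obj :: "'o set"
  Arr :: "'a set"
  dom :: "'a \<Rightarrow> 'o"
  cod :: "'a \<Rightarrow> 'o"
  ident :: "'o \<Rightarrow> 'a"
  compose :: "'a \<Rightarrow> 'a \<Rightarrow> 'a" (infixr "\<cdot>\<index>" 70)

locale category =
  fixes C :: "('o, 'a, 'z) cat_scheme" (structure)
  assumes dom_Obj: "f \<in> Arr C \<Longrightarrow> dom C f \<in> Obj C"
    and cod_Obj: "f \<in> Arr C \<Longrightarrow> cod C f \<in> Obj C"
    and ident_Arr: "X \<in> Obj C \<Longrightarrow> ident C X \<in> Arr C"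
    and dom_ident: "X \<in> Obj C \<Longrightarrow> dom C (ident C X) = X"
    and cod_ident: "X \<in> Obj C \<Longrightarrow> cod C (ident C X) = X"
    and compose_Arr: "\<lbrakk>f \<in> Arr C; g \<in> Arr C; cod C f = dom C g\<rbrakk> \<Longrightarrow> g \<cdot> f \<in> Arr C"
    and dom_compose: "\<lbrakk>f \<in> Arr C; g \<in> Arr C; cod C f = dom C g\<rbrakk> \<Longrightarrow> dom C (g \<cdot> f) = dom C f"
    and cod_compose: "\<lbrakk>f \<in> Arr C; g \<in> Arr C; cod C f = dom C g\<rbrakk> \<Longrightarrow> cod C (g \<cdot> f) = cod C g"
    and compose_assoc:
      "\<lbrakk>f \<in> Arr C; g \<in> Arr C; h \<in> Arr C; cod C f = dom C g; cod C g = dom C h\<rbrakk>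
        \<Longrightarrow> (h \<cdot> g) \<cdot> f = h \<cdot> (g \<cdot> f)"
    and compose_ident: "f \<in> Arr C \<Longrightarrow> f \<cdot> ident C (dom C f) = f"
    and ident_compose: "f \<in> Arr C \<Longrightarrow> ident C (cod C f) \<cdot> f = f"

definition full_subcategory ::
  "('o, 'a, 'z) cat_scheme \<Rightarrow> 'o set \<Rightarrow> ('o, 'a, 'z) cat_scheme" where
  "full_subcategory C S =
     C\<lparr>Obj := S, Arr := {f \<in> Arr C. dom C f \<in> S \<and> cod C f \<in> S}\<rparr>"

definition epic :: "('o, 'a, 'z) cat_scheme \<Rightarrow> 'a \<Rightarrow> bool" where
  "epic C f \<longleftrightarrow> f \<in> Arr C \<and>
     (\<forall>x\<in>Arr C. \<forall>y\<in>Arr C. dom C x = cod C f \<longrightarrow> dom C y = cod C f \<longrightarrow> cod C x = cod C y \<longrightarrow>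
        x \<cdot>\<^bsub>C\<^esub> f = y \<cdot>\<^bsub>C\<^esub> f \<longrightarrow> x = y)"

definition monic :: "('o, 'a, 'z) cat_scheme \<Rightarrow> 'a \<Rightarrow> bool" where
  "monic C f \<longleftrightarrow> f \<in> Arr C \<and>
     (\<forall>x\<in>Arr C. \<forall>y\<in>Arr C. cod C x = dom C f \<longrightarrow> cod C y = dom C f \<longrightarrow> dom C x = dom C y \<longrightarrow>
        f \<cdot>\<^bsub>C\<^esub> x = f \<cdot>\<^bsub>C\<^esub> y \<longrightarrow> x = y)"

definition is_iso :: "('o, 'a, 'z) cat_scheme \<Rightarrow> 'a \<Rightarrow> bool" where
  "is_iso C f \<longleftrightarrow> f \<in> Arr C \<and>
     (\<exists>g\<in>Arr C. dom C g = cod C f \<and> cod C g = dom C f \<and>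
        g \<cdot>\<^bsub>C\<^esub> f = ident C (dom C f) \<and> f \<cdot>\<^bsub>C\<^esub> g = ident C (cod C f))"

text \<open>\<open>is_pullback C f g p q\<close>: the arrows \<open>p : U \<rightarrow> dom f\<close> and \<open>q : U \<rightarrow> dom g\<close> form a
  pullback of \<open>f\<close> and \<open>g\<close>; dually for pushouts.\<close>

definition is_pullback :: "('o, 'a, 'z) cat_scheme \<Rightarrow> 'a \<Rightarrow> 'a \<Rightarrow> 'a \<Rightarrow> 'a \<Rightarrow> bool" where
  "is_pullback C f g p q \<longleftrightarrow>
     f \<in> Arr C \<and> g \<in> Arr C \<and> cod C f = cod C g \<and>
     p \<in> Arr C \<and> q \<in> Arr C \<and> dom C p = dom C q \<and> cod C p = dom C f \<and> cod C q = dom C g \<and>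
     f \<cdot>\<^bsub>C\<^esub> p = g \<cdot>\<^bsub>C\<^esub> q \<and>
     (\<forall>x\<in>Arr C. \<forall>y\<in>Arr C.
        dom C x = dom C y \<longrightarrow> cod C x = dom C f \<longrightarrow> cod C y = dom C g \<longrightarrow>
        f \<cdot>\<^bsub>C\<^esub> x = g \<cdot>\<^bsub>C\<^esub> y \<longrightarrow>
        (\<exists>!h. h \<in> Arr C \<and> dom C h = dom C x \<and> cod C h = dom C p \<and>
              p \<cdot>\<^bsub>C\<^esub> h = x \<and> q \<cdot>\<^bsub>C\<^esub> h = y))"

definition is_pushout :: "('o, 'a, 'z) cat_scheme \<Rightarrow> 'a \<Rightarrow> 'a \<Rightarrow> 'a \<Rightarrow> 'a \<Rightarrow> bool" where
  "is_pushout C f g r s \<longleftrightarrow>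
     f \<in> Arr C \<and> g \<in> Arr C \<and> dom C f = dom C g \<and>
     r \<in> Arr C \<and> s \<in> Arr C \<and> cod C r = cod C s \<and> dom C r = cod C f \<and> dom C s = cod C g \<and>
     r \<cdot>\<^bsub>C\<^esub> f = s \<cdot>\<^bsub>C\<^esub> g \<and>
     (\<forall>x\<in>Arr C. \<forall>y\<in>Arr C.
        cod C x = cod C y \<longrightarrow> dom C x = cod C f \<longrightarrow> dom C y = cod C g \<longrightarrow>
        x \<cdot>\<^bsub>C\<^esub> f = y \<cdot>\<^bsub>C\<^esub> g \<longrightarrow>
        (\<exists>!h. h \<in> Arr C \<and> dom C h = cod C r \<and> cod C h = cod C x \<and>
              h \<cdot>\<^bsub>C\<^esub> r = x \<and> h \<cdot>\<^bsub>C\<^esub> s = y))"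

definition Hom :: "('o, 'a, 'z) cat_scheme \<Rightarrow> 'a \<Rightarrow> 'a \<Rightarrow> 'a set" where
  "Hom C g f = {h \<in> Arr C. dom C h = dom C g \<and> cod C h = dom C f \<and> g = f \<cdot>\<^bsub>C\<^esub> h}"

text \<open>Besides the category, the data are the objects \<open>DObj\<close> of the full subcategory,
  the choice \<open>Sig U\<close> of arrows into each object \<open>U\<close>, and the degree function, of which
  only the values on arrows with codomain in \<open>DObj\<close> (\<open>deg_arrows\<close>) matter.\<close>

record ('o, 'a) galois_cat = "('o, 'a) cat" +
  DObj :: "'o set"
  Sig :: "'o \<Rightarrow> 'a set"
  deg :: "'a \<Rightarrow> nat"

definition subcatD :: "('o, 'a, 'z) galois_cat_scheme \<Rightarrow> ('o, 'a, 'z) galois_cat_scheme" where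
  "subcatD K = full_subcategory K (DObj K)"

definition cover :: "('o, 'a, 'z) galois_cat_scheme \<Rightarrow> 'a \<Rightarrow> bool" where
  "cover K f \<longleftrightarrow> f \<in> Arr (subcatD K)"

definition deg_arrows :: "('o, 'a, 'z) galois_cat_scheme \<Rightarrow> 'a set" where
  "deg_arrows K = {f \<in> Arr K. cod K f \<in> DObj K}"

text \<open>Pushouts, epic and monic arrows and inverses are taken inside the category
  \<open>subcatD K\<close>, pullbacks in the ambient category.\<close>

locale galois_category = category K for K :: "('o, 'a) galois_cat" (structure) +
  assumes DObj_subset: "DObj K \<subseteq> Obj K"
    and G1: "\<lbrakk>cover K f; cover K g; cod K f = cod K g\<rbrakk> \<Longrightarrow> \<exists>p q. is_pullback K f g p q"
    and G2_I: "\<lbrakk>cover K f; cover K g; dom K f = dom K g\<rbrakk> \<Longrightarrow> \<exists>r s. is_pushout (subcatD K) f g r s"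
    and G2_II: "cover K f \<Longrightarrow> epic (subcatD K) f"
    and G2_III: "monic (subcatD K) f \<Longrightarrow> is_iso (subcatD K) f"
    and G3_Sig: "\<lbrakk>U \<in> Obj K; i \<in> Sig K U\<rbrakk> \<Longrightarrow> i \<in> Arr K \<and> dom K i \<in> DObj K \<and> cod K i = U"
    and G3_unique: "\<lbrakk>u \<in> Arr K; dom K u \<in> DObj K\<rbrakk>
        \<Longrightarrow> \<exists>!i. i \<in> Sig K (cod K u) \<and> Hom K u i \<noteq> {}"
    and G4_pos: "f \<in> deg_arrows K \<Longrightarrow> 0 < deg K f"
    and G4_I: "\<lbrakk>f \<in> deg_arrows K; g \<in> deg_arrows K; cod K f = dom K g; g \<cdot> f \<in> deg_arrows K\<rbrakk>
        \<Longrightarrow> deg K (g \<cdot> f) = deg K g * deg K f"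
    and G4_II: "f \<in> deg_arrows K
        \<Longrightarrow> finite (Sig K (dom K f)) \<and> deg K f = (\<Sum>i\<in>Sig K (dom K f). deg K (f \<cdot> i))"
    and G4_III: "\<lbrakk>cover K f; cover K g; is_pullback K f g p q\<rbrakk>
        \<Longrightarrow> deg K f = deg K q \<and> deg K g = deg K p"

definition Aut :: "('o, 'a, 'z) galois_cat_scheme \<Rightarrow> 'a \<Rightarrow> 'a set" where
  "Aut K f = {h \<in> Hom K f f. is_iso K h}"

definition galois_cover :: "('o, 'a, 'z) galois_cat_scheme \<Rightarrow> 'a \<Rightarrow> bool" where
  "galois_cover K f \<longleftrightarrow> cover K f \<and> finite (Aut K f) \<and> card (Aut K f) = deg K f"

definition below :: "('o, 'a, 'z) galois_cat_scheme \<Rightarrow> 'a \<Rightarrow> 'a \<Rightarrow> bool" where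
  "below K f g \<longleftrightarrow> cod K f = cod K g \<and> Hom K g f \<noteq> {}"

definition minimal_cover ::
  "('o, 'a, 'z) galois_cat_scheme \<Rightarrow> ('a \<Rightarrow> bool) \<Rightarrow> 'a \<Rightarrow> bool" where
  "minimal_cover K P g \<longleftrightarrow>
     cover K g \<and> P g \<and> (\<forall>h. cover K h \<and> P h \<and> below K h g \<longrightarrow> below K g h)"

definition galois_closure :: "('o, 'a, 'z) galois_cat_scheme \<Rightarrow> 'a \<Rightarrow> 'a \<Rightarrow> bool" where
  "galois_closure K f g \<longleftrightarrow> minimal_cover K (\<lambda>g. galois_cover K g \<and> below K f g) g"

text \<open>The algorithm as a nondeterministic machine with program locations \<open>At1\<close>
  (compare the counter \<open>n\<close> with the degree of the input), \<open>At2\<close> (choose a pullback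
  \<open>(p, q)\<close> of the input and the current arrow \<open>g\<close>), \<open>At3\<close> (inspect the degrees
  \<open>deg (q \<cdot> i)\<close>), \<open>At4\<close> (choose \<open>i\<close>) and \<open>At5\<close> (replace \<open>g\<close>). The object carrying
  the pullback is \<open>dom q\<close>.\<close>

datatype 'a config =
    At1 'a nat
  | At2 'a nat
  | At3 'a nat 'a 'a
  | At4 'a nat 'a 'a
  | At5 'a nat 'a 'a 'a
  | Output 'a

text \<open>\<open>PB f g\<close> is the set of pairs \<open>(p, q)\<close> among which \<open>At2\<close> may choose;
  \<open>f\<close> is the input. The degree of a cover is positive, so \<open>deg K f - 1\<close> is not truncated.\<close>

inductive alg_step ::
  "('o, 'a, 'z) galois_cat_scheme \<Rightarrow> ('a \<Rightarrow> 'a \<Rightarrow> ('a \<times> 'a) set) \<Rightarrow> 'a \<Rightarrow>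
     'a config \<Rightarrow> 'a config \<Rightarrow> bool"
  for K PB f where
  step1_output: "n \<ge> deg K f - 1 \<Longrightarrow> alg_step K PB f (At1 g n) (Output g)"
| step1_else: "\<not> n \<ge> deg K f - 1 \<Longrightarrow> alg_step K PB f (At1 g n) (At2 g n)"
| step2: "(p, q) \<in> PB f g \<Longrightarrow> alg_step K PB f (At2 g n) (At3 g n p q)"
| step3_output: "\<forall>i\<in>Sig K (dom K q). deg K (q \<cdot>\<^bsub>K\<^esub> i) = 1
    \<Longrightarrow> alg_step K PB f (At3 g n p q) (Output g)"
| step3_else: "\<not> (\<forall>i\<in>Sig K (dom K q). deg K (q \<cdot>\<^bsub>K\<^esub> i) = 1)
    \<Longrightarrow> alg_step K PB f (At3 g n p q) (At4 g n p q)"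
| step4: "\<lbrakk>i \<in> Sig K (dom K q); deg K (q \<cdot>\<^bsub>K\<^esub> i) > 1\<rbrakk>
    \<Longrightarrow> alg_step K PB f (At4 g n p q) (At5 g n p q i)"
| step5: "alg_step K PB f (At5 g n p q i) (At1 (g \<cdot>\<^bsub>K\<^esub> (q \<cdot>\<^bsub>K\<^esub> i)) (n + 1))"

definition alg_start :: "'a \<Rightarrow> 'a config" where
  "alg_start f = At1 f 1"

definition alg_output ::
  "('o, 'a, 'z) galois_cat_scheme \<Rightarrow> ('a \<Rightarrow> 'a \<Rightarrow> ('a \<times> 'a) set) \<Rightarrow> 'a \<Rightarrow> 'a \<Rightarrow> bool" where
  "alg_output K PB f g \<longleftrightarrow> (alg_step K PB f)\<^sup>*\<^sup>* (alg_start f) (Output g)"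

definition all_pullbacks :: "('o, 'a, 'z) cat_scheme \<Rightarrow> 'a \<Rightarrow> 'a \<Rightarrow> ('a \<times> 'a) set" where
  "all_pullbacks C f g = {(p, q). is_pullback C f g p q}"

text \<open>The three subroutines used by the algorithm. \<open>find_pb f g\<close> is the set of possible
  results of the (possibly nondeterministic) search for a pullback of \<open>f\<close> and \<open>g\<close>, and
  \<open>pb_time f g (p, q)\<close> is the time after which the result \<open>(p, q)\<close> is delivered;
  \<open>Sig_time U\<close> and \<open>deg_time f\<close> are the times for determining \<open>Sig U\<close> and \<open>deg f\<close>.
  The value \<open>\<infinity>\<close> means that the computation never ends.\<close>

record ('o, 'a) subroutines =
  find_pb :: "'a \<Rightarrow> 'a \<Rightarrow> ('a \<times> 'a) set"
  pb_time :: "'a \<Rightarrow> 'a \<Rightarrow> 'a \<times> 'a \<Rightarrow> enat"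
  Sig_time :: "'o \<Rightarrow> enat"
  deg_time :: "'a \<Rightarrow> enat"

definition pullbacks_in_finite_time ::
  "('o, 'a, 'z) galois_cat_scheme \<Rightarrow> ('o, 'a) subroutines \<Rightarrow> bool" where
  "pullbacks_in_finite_time K T \<longleftrightarrow>
     (\<forall>f g. cover K f \<and> cover K g \<and> cod K f = cod K g \<longrightarrow>
        find_pb T f g \<noteq> {} \<and>
        (\<forall>(p, q) \<in> find_pb T f g. is_pullback K f g p q \<and> pb_time T f g (p, q) < \<infinity>))"

definition Sig_in_finite_time ::
  "('o, 'a, 'z) galois_cat_scheme \<Rightarrow> ('o, 'a) subroutines \<Rightarrow> bool" where
  "Sig_in_finite_time K T \<longleftrightarrow> (\<forall>U\<in>Obj K. Sig_time T U < \<infinity>)"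

definition deg_in_finite_time ::
  "('o, 'a, 'z) galois_cat_scheme \<Rightarrow> ('o, 'a) subroutines \<Rightarrow> bool" where
  "deg_in_finite_time K T \<longleftrightarrow> (\<forall>f. cover K f \<longrightarrow> deg_time T f < \<infinity>)"

text \<open>Apart from the subroutine calls each step costs one unit (comparisons,
  compositions, updates of variables). The degrees needed in \<open>At4\<close> are already
  known from \<open>At3\<close>.\<close>

fun step_time ::
  "('o, 'a, 'z) galois_cat_scheme \<Rightarrow> ('o, 'a) subroutines \<Rightarrow> 'a \<Rightarrow>
     'a config \<Rightarrow> 'a config \<Rightarrow> enat" where
  "step_time K T f (At1 g n) c' = deg_time T f + 1"
| "step_time K T f (At2 g n) (At3 g' n' p q) = pb_time T f g (p, q) + Sig_time T (dom K q) + 1"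
| "step_time K T f (At3 g n p q) c' = (\<Sum>i\<in>Sig K (dom K q). deg_time T (q \<cdot>\<^bsub>K\<^esub> i)) + 1"
| "step_time K T f c c' = 1"

text \<open>Termination on input \<open>f\<close>, whatever choices are made: there is no infinite
  execution, an execution can stop only by returning an output, and every execution
  takes finite time.\<close>

definition alg_terminates ::
  "('o, 'a, 'z) galois_cat_scheme \<Rightarrow> ('o, 'a) subroutines \<Rightarrow> 'a \<Rightarrow> bool" where
  "alg_terminates K T f \<longleftrightarrow>
     \<not> (\<exists>r. r 0 = alg_start f \<and> (\<forall>k. alg_step K (find_pb T) f (r k) (r (Suc k)))) \<and>
     (\<forall>c. (alg_step K (find_pb T) f)\<^sup>*\<^sup>* (alg_start f) c \<longrightarrow>
        (\<exists>c'. alg_step K (find_pb T) f c c') \<or> (\<exists>g. c = Output g)) \<and>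
     (\<forall>r N. r 0 = alg_start f \<and> (\<forall>k<N. alg_step K (find_pb T) f (r k) (r (Suc k))) \<longrightarrow>
        (\<Sum>k<N. step_time K T f (r k) (r (Suc k))) < \<infinity>)"

end

(* Let U be the pullback of f and g with projection q to dom g. Sections of q correspond to the
   components i in Sig U with deg (q i) = 1, so |Hom (g, f)| counts these components and is at most
   deg f; say that g splits f if equality holds. Replacing g by g q i with deg (q i) > 1 increases
   |Hom (g, f)|, because the new element p i of Hom (g q i, f) does not come from Hom (g, f). Hence
   |Hom (g, f)| >= n throughout; it cannot equal deg f - 1, since the one remaining component would
   have degree 1, so the output splits f.
   Comparing degrees over all components of U shows that every cover that splits f also splits each g
   constructed from f. The output therefore splits itself, that is, it is Galois; and a Galois cover
   above f splits f, hence splits g, hence lies above g. *)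

theory Submission
  imports Defs
begin

text \<open>Serves twice: for the degrees computed within one inspection of the components, and for
  the total time of a run.\<close>

lemma sum_enat_finite:
  fixes t :: "'b \<Rightarrow> enat"
  assumes "\<And>x. x \<in> A \<Longrightarrow> t x < \<infinity>"
  shows "sum t A < \<infinity>"
  using assms
proof (induction A rule: infinite_finite_induct)
  case (insert x A)
  then have "t x < \<infinity>" "sum t A < \<infinity>" by auto
  with insert show ?case by (simp add: plus_eq_infty_iff_enat)
qed auto

context galois_category
begin

section \<open>Covers, \<open>Hom\<close> and inverses in the subcategory\<close>

lemma cover_iff: "cover K f \<longleftrightarrow> f \<in> Arr K \<and> dom K f \<in> DObj K \<and> cod K f \<in> DObj K"
  by (auto simp: cover_def subcatD_def full_subcategory_def)

lemma cover_ArrD: "cover K f \<Longrightarrow> f \<in> Arr K"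
  by (simp add: cover_iff)

lemma cover_compose: "\<lbrakk>cover K f; cover K g; cod K f = dom K g\<rbrakk> \<Longrightarrow> cover K (g \<cdot> f)"
  by (simp add: cover_iff compose_Arr dom_compose cod_compose)

lemma cover_ident: "A \<in> DObj K \<Longrightarrow> cover K (ident K A)"
  using DObj_subset by (auto simp: cover_iff ident_Arr dom_ident cod_ident)

lemma HomD:
  assumes "h \<in> Hom K g f"
  shows "h \<in> Arr K" "dom K h = dom K g" "cod K h = dom K f" "f \<cdot> h = g"
  using assms by (auto simp: Hom_def)

lemma HomI:
  "\<lbrakk>h \<in> Arr K; dom K h = dom K g; cod K h = dom K f; f \<cdot> h = g\<rbrakk> \<Longrightarrow> h \<in> Hom K g f"
  by (auto simp: Hom_def)

lemma Hom_cover: "\<lbrakk>h \<in> Hom K g f; cover K g; cover K f\<rbrakk> \<Longrightarrow> cover K h"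
  by (simp add: cover_iff HomD)

lemma ident_in_Hom: "f \<in> Arr K \<Longrightarrow> ident K (dom K f) \<in> Hom K f f"
  by (intro HomI) (simp_all add: ident_Arr dom_ident cod_ident dom_Obj compose_ident)

lemma cover_epic:
  assumes "cover K f" "cover K x" "cover K y" "dom K x = cod K f" "dom K y = cod K f"
    "cod K x = cod K y" "x \<cdot> f = y \<cdot> f"
  shows "x = y"
  using G2_II[OF assms(1)] assms
  by (auto simp: epic_def subcatD_def full_subcategory_def cover_iff)

lemma monic_cover_inverse:
  assumes "cover K m"
    and "\<And>x y. \<lbrakk>cover K x; cover K y; cod K x = dom K m; cod K y = dom K m; dom K x = dom K y;
            m \<cdot> x = m \<cdot> y\<rbrakk> \<Longrightarrow> x = y"
  obtains k where "cover K k" "dom K k = cod K m" "cod K k = dom K m"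
    "k \<cdot> m = ident K (dom K m)" "m \<cdot> k = ident K (cod K m)"
proof -
  have "monic (subcatD K) m"
    using assms by (auto simp: monic_def subcatD_def full_subcategory_def cover_iff)
  from G2_III[OF this] show thesis
    using that by (auto simp: is_iso_def subcatD_def full_subcategory_def cover_iff)
qed

text \<open>Having the left inverse \<open>r\<close>, the cover \<open>s\<close> is monic, so the
  axiom on monic arrows gives it a right inverse \<open>t\<close>. Then
  \<open>r = r \<cdot> (s \<cdot> t) = (r \<cdot> s) \<cdot> t = t\<close>.\<close>

lemma left_inverse_imp_right_inverse:
  assumes s: "cover K s" and r: "cover K r" and cr: "cod K s = dom K r"
    and rs: "r \<cdot> s = ident K (dom K s)"
  shows "s \<cdot> r = ident K (dom K r)"
proof -
  note A = cover_ArrD[OF s] cover_ArrD[OF r]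
  have codr: "cod K r = dom K s"
    using arg_cong[OF rs, of "cod K"] A cr by (simp add: cod_compose cod_ident dom_Obj)
  obtain t where t: "cover K t" "dom K t = cod K s" "cod K t = dom K s"
    "s \<cdot> t = ident K (cod K s)"
  proof (rule monic_cover_inverse[OF s])
    fix x y
    assume xy: "cover K x" "cover K y" "cod K x = dom K s" "cod K y = dom K s"
      "s \<cdot> x = s \<cdot> y"
    then have "(r \<cdot> s) \<cdot> x = (r \<cdot> s) \<cdot> y"
      using A cr by (simp add: compose_assoc cover_ArrD)
    then show "x = y"
      using xy rs by (metis cover_ArrD ident_compose)
  qed
  have "r = r \<cdot> (s \<cdot> t)"
    using t cr A compose_ident by simp
  also have "\<dots> = (r \<cdot> s) \<cdot> t"
    using t cr A by (simp add: compose_assoc cover_ArrD)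
  also have "\<dots> = t"
    using t rs ident_compose cover_ArrD by metis
  finally show ?thesis
    using t cr by simp
qed

section \<open>Degrees of composites and identities\<close>

lemma cover_deg_pos: "cover K f \<Longrightarrow> 0 < deg K f"
  by (rule G4_pos) (simp add: cover_iff deg_arrows_def)

lemma deg_compose: "\<lbrakk>cover K f; cover K g; cod K f = dom K g\<rbrakk> \<Longrightarrow> deg K (g \<cdot> f) = deg K g * deg K f"
  by (rule G4_I) (simp_all add: cover_iff deg_arrows_def compose_Arr cod_compose)

text \<open>The identity is idempotent, so its degree is a positive integer equal to its own
  square.\<close>

lemma deg_ident:
  assumes "A \<in> DObj K"
  shows "deg K (ident K A) = 1"
proof -
  have c: "cover K (ident K A)" and A: "A \<in> Obj K"
    using assms cover_ident DObj_subset by auto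
  have "deg K (ident K A \<cdot> ident K A) = deg K (ident K A) * deg K (ident K A)"
    using c A by (intro deg_compose) (simp_all add: dom_ident cod_ident)
  moreover have "ident K A \<cdot> ident K A = ident K A"
    using A compose_ident[OF ident_Arr, of A] by (simp add: dom_ident)
  ultimately show ?thesis
    using cover_deg_pos[OF c] by simp
qed

section \<open>Pullbacks and their components\<close>

lemma pullbackD:
  assumes "is_pullback K f g p q"
  shows "p \<in> Arr K" "q \<in> Arr K" "dom K p = dom K q" "cod K p = dom K f" "cod K q = dom K g"
    "f \<cdot> p = g \<cdot> q"
  using assms by (auto simp: is_pullback_def)

lemma pullback_pair:
  assumes "is_pullback K f g p q" "x \<in> Arr K" "y \<in> Arr K" "dom K x = dom K y"
    "cod K x = dom K f" "cod K y = dom K g" "f \<cdot> x = g \<cdot> y"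
  obtains h where "h \<in> Arr K" "dom K h = dom K x" "cod K h = dom K q" "p \<cdot> h = x" "q \<cdot> h = y"
  using assms unfolding is_pullback_def by metis

lemma pullback_unique:
  assumes pb: "is_pullback K f g p q" and h: "h \<in> Arr K" "cod K h = dom K q"
    and h': "h' \<in> Arr K" "cod K h' = dom K q" and "dom K h = dom K h'"
    and "p \<cdot> h = p \<cdot> h'" "q \<cdot> h = q \<cdot> h'"
  shows "h = h'"
proof -
  note P = pullbackD[OF pb]
  have fg: "f \<in> Arr K" "g \<in> Arr K" using pb by (auto simp: is_pullback_def)
  have eq: "f \<cdot> (p \<cdot> h) = g \<cdot> (q \<cdot> h)"
    using P fg h compose_assoc[of h p f] compose_assoc[of h q g] by simp
  have "\<exists>!k. k \<in> Arr K \<and> dom K k = dom K (p \<cdot> h) \<and> cod K k = dom K p \<and>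
      p \<cdot> k = p \<cdot> h \<and> q \<cdot> k = q \<cdot> h"
  proof -
    have "p \<cdot> h \<in> Arr K" "q \<cdot> h \<in> Arr K" "dom K (p \<cdot> h) = dom K (q \<cdot> h)"
      "cod K (p \<cdot> h) = dom K f" "cod K (q \<cdot> h) = dom K g"
      using P h by (simp_all add: compose_Arr dom_compose cod_compose)
    with eq show ?thesis using pb unfolding is_pullback_def by blast
  qed
  moreover have "dom K (p \<cdot> h) = dom K h" using P h by (simp add: dom_compose)
  ultimately show ?thesis
    using assms P by (metis (no_types, lifting))
qed

lemma Sig_factor:
  assumes "u \<in> Arr K" "dom K u \<in> DObj K"
  obtains i k where "i \<in> Sig K (cod K u)" "k \<in> Hom K u i"
  using G3_unique[OF assms] by blast

lemma Sig_unique: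
  assumes "u \<in> Arr K" "dom K u \<in> DObj K" "i \<in> Sig K (cod K u)" "j \<in> Sig K (cod K u)"
    "k \<in> Hom K u i" "l \<in> Hom K u j"
  shows "i = j"
  using G3_unique[OF assms(1,2)] assms(3-) by blast

lemma SigD:
  assumes "is_pullback K f g p q" "i \<in> Sig K (dom K q)"
  shows "i \<in> Arr K" "dom K i \<in> DObj K" "cod K i = dom K q"
  using G3_Sig[OF dom_Obj assms(2)] pullbackD[OF assms(1)] by auto

lemma component_cover:
  assumes "cover K g" "is_pullback K f g p q" "i \<in> Sig K (dom K q)"
  shows "cover K (q \<cdot> i)" "dom K (q \<cdot> i) = dom K i" "cod K (q \<cdot> i) = dom K g"
  using assms SigD[OF assms(2,3)] pullbackD[OF assms(2)]
  by (auto simp: cover_iff compose_Arr dom_compose cod_compose)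

text \<open>Base change preserves degree, so \<open>deg K f = deg K q\<close>, and the degree of
  \<open>q\<close> is the sum over the components of its domain.\<close>

lemma pullback_deg_sum:
  assumes "cover K f" "cover K g" "is_pullback K f g p q"
  shows "finite (Sig K (dom K q))" "deg K f = (\<Sum>i\<in>Sig K (dom K q). deg K (q \<cdot> i))"
proof -
  have "q \<in> deg_arrows K"
    using pullbackD[OF assms(3)] assms(2) by (simp add: deg_arrows_def cover_iff)
  from G4_II[OF this] G4_III[OF assms]
  show "finite (Sig K (dom K q))" "deg K f = (\<Sum>i\<in>Sig K (dom K q). deg K (q \<cdot> i))"
    by auto
qed

section \<open>Covers of degree one are isomorphisms\<close>

text \<open>It suffices that \<open>f\<close> is monic. The pullback of \<open>f\<close> with itself
  has a single component, the diagonal factors through it, and therefore both projections agree on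
  it; so arrows identified by \<open>f\<close> are equal.\<close>

lemma deg_one_inverse:
  assumes f: "cover K f" and "deg K f = 1"
  obtains k where "cover K k" "dom K k = cod K f" "cod K k = dom K f"
    "k \<cdot> f = ident K (dom K f)" "f \<cdot> k = ident K (cod K f)"
proof (rule monic_cover_inverse[OF f _ that])
  fix x y
  assume x: "cover K x" "cod K x = dom K f" and y: "cover K y" "cod K y = dom K f"
    and xy: "dom K x = dom K y" "f \<cdot> x = f \<cdot> y"
  obtain p q where pb: "is_pullback K f f p q" using G1[OF f f] by blast
  note P = pullbackD[OF pb] and fA = cover_ArrD[OF f]
  \<comment> \<open>Every component contributes at least 1 to a sum equal to
    \<open>deg K f = 1\<close>.\<close>
  have single: "i = j" if "i \<in> Sig K (dom K q)" "j \<in> Sig K (dom K q)" for i j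
  proof (rule ccontr)
    assume ne: "i \<noteq> j"
    have "(\<Sum>i\<in>{i, j}. deg K (q \<cdot> i)) \<le> deg K f"
      unfolding pullback_deg_sum(2)[OF f f pb]
      using that pullback_deg_sum(1)[OF f f pb] by (intro sum_mono2) auto
    moreover have "0 < deg K (q \<cdot> i)" "0 < deg K (q \<cdot> j)"
      using that by (auto intro!: cover_deg_pos component_cover[OF f pb])
    ultimately show False using ne assms(2) by simp
  qed
  let ?I = "ident K (dom K f)"
  have I: "?I \<in> Arr K" "dom K ?I = dom K f" "cod K ?I = dom K f"
    using fA by (simp_all add: ident_Arr dom_ident cod_ident dom_Obj)
  \<comment> \<open>\<open>d\<close> is the diagonal of the pullback of \<open>f\<close> with
    itself.\<close>
  obtain d where d: "d \<in> Arr K" "dom K d = dom K f" "cod K d = dom K q" "p \<cdot> d = ?I" "q \<cdot> d = ?I"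
    using pullback_pair[OF pb I(1) I(1)] I by metis
  obtain i e where i: "i \<in> Sig K (dom K q)" and e: "e \<in> Hom K d i"
    using Sig_factor[of d] d f by (metis cover_iff)
  note i' = SigD[OF pb i] and e' = HomD[OF e]
  have pi: "cover K (p \<cdot> i)" "dom K (p \<cdot> i) = dom K i"
    and qi: "cover K (q \<cdot> i)" "dom K (q \<cdot> i) = dom K i"
    using P i' f by (auto simp: cover_iff compose_Arr dom_compose cod_compose)
  have ec: "cover K e" using e' i' d f by (simp add: cover_iff)
  have pe: "(p \<cdot> i) \<cdot> e = ident K (dom K e)" and qe: "(q \<cdot> i) \<cdot> e = ident K (dom K e)"
    using P i' e' d by (simp_all add: compose_assoc)
  have "e \<cdot> (p \<cdot> i) = ident K (dom K i)" "e \<cdot> (q \<cdot> i) = ident K (dom K i)"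
    using left_inverse_imp_right_inverse[OF ec pi(1) _ pe]
      left_inverse_imp_right_inverse[OF ec qi(1) _ qe] pi qi e' by simp_all
  \<comment> \<open>Both \<open>p \<cdot> i\<close> and \<open>q \<cdot> i\<close> are two-sided
    inverses of \<open>e\<close>, hence equal.\<close>
  have "p \<cdot> i = p \<cdot> i \<cdot> (e \<cdot> (q \<cdot> i))"
    using \<open>e \<cdot> (q \<cdot> i) = _\<close> i' P compose_ident by simp
  also have "\<dots> = ((p \<cdot> i) \<cdot> e) \<cdot> (q \<cdot> i)"
    using P(1-5) i' e'(1-3) d qi pi
    by (simp add: compose_assoc compose_Arr dom_compose cod_compose)
  also have "\<dots> = q \<cdot> i"
    unfolding pe using e'(2) d(2) P(2,5) i' ident_compose[of "q \<cdot> i"]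
    by (simp add: compose_Arr cod_compose)
  finally have pq: "p \<cdot> i = q \<cdot> i" .
  \<comment> \<open>The pair \<open>(x, y)\<close> is an arrow into the pullback; it factors through
    the only component, where the projections coincide.\<close>
  obtain u where u: "u \<in> Arr K" "dom K u = dom K x" "cod K u = dom K q" "p \<cdot> u = x" "q \<cdot> u = y"
    using pullback_pair[OF pb cover_ArrD[OF x(1)] cover_ArrD[OF y(1)]] x y xy by metis
  obtain j k where j: "j \<in> Sig K (dom K q)" and k: "k \<in> Hom K u j"
    using Sig_factor[of u] u x by (metis cover_iff)
  have "j = i" using single i j by simp
  with HomD[OF k] have k': "k \<in> Arr K" "cod K k = dom K i" "i \<cdot> k = u" by auto
  have "x = (p \<cdot> i) \<cdot> k" "y = (q \<cdot> i) \<cdot> k"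
    using k' i' P u by (simp_all add: compose_assoc)
  then show "x = y" using pq by simp
qed

section \<open>Counting \<open>Hom\<close> by components of the pullback\<close>

text \<open>Arrows \<open>h\<close> with \<open>g = f \<cdot> h\<close> are sections of the pullback projection \<open>q\<close>, and the image of a
  section is a component of degree one.\<close>

lemma Hom_card_components:
  assumes f: "cover K f" and g: "cover K g" and pb: "is_pullback K f g p q"
  shows "finite (Hom K g f)"
    "card (Hom K g f) = card {i \<in> Sig K (dom K q). deg K (q \<cdot> i) = 1}"
proof -
  note P = pullbackD[OF pb]
  let ?N = "{i \<in> Sig K (dom K q). deg K (q \<cdot> i) = 1}" and ?I = "ident K (dom K g)"
  have I: "?I \<in> Arr K" "dom K ?I = dom K g" "cod K ?I = dom K g"
    using cover_ArrD[OF g] by (simp_all add: ident_Arr dom_ident cod_ident dom_Obj)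
  \<comment> \<open>For a component of degree one, \<open>q \<cdot> i\<close> has an inverse
    \<open>k i\<close>, so \<open>i \<cdot> k i\<close> is a section of \<open>q\<close>.\<close>
  have "\<forall>i\<in>?N. \<exists>k. cover K k \<and> dom K k = dom K g \<and> cod K k = dom K i \<and>
      k \<cdot> (q \<cdot> i) = ident K (dom K i) \<and> (q \<cdot> i) \<cdot> k = ?I"
  proof
    fix i assume "i \<in> ?N"
    then have i: "i \<in> Sig K (dom K q)" and d: "deg K (q \<cdot> i) = 1" by auto
    from deg_one_inverse[OF component_cover(1)[OF g pb i] d] component_cover[OF g pb i]
    show "\<exists>k. cover K k \<and> dom K k = dom K g \<and> cod K k = dom K i \<and>
      k \<cdot> (q \<cdot> i) = ident K (dom K i) \<and> (q \<cdot> i) \<cdot> k = ?I"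
      by metis
  qed
  from bchoice[OF this] obtain k where k: "\<forall>i\<in>?N. cover K (k i) \<and> dom K (k i) = dom K g \<and>
      cod K (k i) = dom K i \<and> k i \<cdot> (q \<cdot> i) = ident K (dom K i) \<and> (q \<cdot> i) \<cdot> k i = ?I"
    by blast
  have ik: "i \<cdot> k i \<in> Arr K" "dom K (i \<cdot> k i) = dom K g" "cod K (i \<cdot> k i) = dom K q"
    "q \<cdot> (i \<cdot> k i) = ?I" "k i \<in> Hom K (i \<cdot> k i) i" "p \<cdot> (i \<cdot> k i) \<in> Hom K g f"
    if "i \<in> ?N" for i
  proof -
    have i: "i \<in> Sig K (dom K q)" using that by simp
    note i' = SigD[OF pb i]
    have ki: "k i \<in> Arr K" "dom K (k i) = dom K g" "cod K (k i) = dom K i" "(q \<cdot> i) \<cdot> k i = ?I"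
      using k that by (auto simp: cover_iff)
    show 1: "i \<cdot> k i \<in> Arr K" "dom K (i \<cdot> k i) = dom K g" "cod K (i \<cdot> k i) = dom K q"
      using i' ki by (simp_all add: compose_Arr dom_compose cod_compose)
    show 2: "q \<cdot> (i \<cdot> k i) = ?I"
      using i' ki P by (simp add: compose_assoc)
    show "k i \<in> Hom K (i \<cdot> k i) i"
      using ki 1 by (intro HomI) auto
    have "f \<cdot> (p \<cdot> (i \<cdot> k i)) = (f \<cdot> p) \<cdot> (i \<cdot> k i)"
      using P(1-5) 1 cover_ArrD[OF f] by (simp add: compose_assoc)
    also have "\<dots> = g \<cdot> (q \<cdot> (i \<cdot> k i))"
      unfolding P(6) using P(1-5) 1 cover_ArrD[OF g] by (simp add: compose_assoc)
    also have "\<dots> = g"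
      using 2 g by (simp add: compose_ident cover_ArrD)
    finally show "p \<cdot> (i \<cdot> k i) \<in> Hom K g f"
      using P 1 by (intro HomI) (simp_all add: compose_Arr dom_compose cod_compose)
  qed
  have "bij_betw (\<lambda>i. p \<cdot> (i \<cdot> k i)) ?N (Hom K g f)"
  proof (rule bij_betw_imageI)
    show "inj_on (\<lambda>i. p \<cdot> (i \<cdot> k i)) ?N"
    proof (rule inj_onI)
      fix i j assume i: "i \<in> ?N" and j: "j \<in> ?N" and eq: "p \<cdot> (i \<cdot> k i) = p \<cdot> (j \<cdot> k j)"
      have same: "i \<cdot> k i = j \<cdot> k j"
        by (rule pullback_unique[OF pb]) (simp_all only: ik(1-4)[OF i] ik(1-4)[OF j] eq)
      show "i = j"
      proof (rule Sig_unique)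
        show "i \<cdot> k i \<in> Arr K" "dom K (i \<cdot> k i) \<in> DObj K" "i \<in> Sig K (cod K (i \<cdot> k i))"
          "j \<in> Sig K (cod K (i \<cdot> k i))" "k i \<in> Hom K (i \<cdot> k i) i"
          using i j ik[OF i] g by (auto simp: cover_iff)
        show "k j \<in> Hom K (i \<cdot> k i) j" using ik[OF j] same by simp
      qed
    qed
    show "(\<lambda>i. p \<cdot> (i \<cdot> k i)) ` ?N = Hom K g f"
    proof (intro equalityI subsetI)
      show "h \<in> Hom K g f" if "h \<in> (\<lambda>i. p \<cdot> (i \<cdot> k i)) ` ?N" for h
        using that ik(6) by blast
      fix h assume h: "h \<in> Hom K g f"
      note h' = HomD[OF h]
      \<comment> \<open>The section of \<open>q\<close> belonging to \<open>h\<close> is the arrow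
        into the pullback with projections \<open>h\<close> and the identity.\<close>
      obtain s where s: "s \<in> Arr K" "dom K s = dom K g" "cod K s = dom K q" "p \<cdot> s = h" "q \<cdot> s = ?I"
        using pullback_pair[OF pb h'(1) I(1)] h' I g by (metis compose_ident cover_ArrD)
      obtain i l where i: "i \<in> Sig K (dom K q)" and l: "l \<in> Hom K s i"
        using Sig_factor[of s] s g by (metis cover_iff)
      note i' = SigD[OF pb i] and l' = HomD[OF l] and qi = component_cover[OF g pb i]
      have lc: "cover K l" using l' s i' g by (simp add: cover_iff)
      have ql: "(q \<cdot> i) \<cdot> l = ?I"
        using l' i' P s by (simp add: compose_assoc)
      \<comment> \<open>The composite of \<open>l\<close> and \<open>q \<cdot> i\<close> is an
        identity, so multiplicativity forces degree one on the component met by the section.\<close>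
      have "deg K (q \<cdot> i) * deg K l = 1"
        using deg_compose[OF lc qi(1)] ql deg_ident[of "dom K g"] g l' qi by (simp add: cover_iff)
      then have iN: "i \<in> ?N" using i by simp
      have ki: "k i \<in> Arr K" "dom K (k i) = dom K g" "cod K (k i) = dom K i"
          "k i \<cdot> (q \<cdot> i) = ident K (dom K i)"
        using k iN by (auto simp: cover_iff)
      have "l = (k i \<cdot> (q \<cdot> i)) \<cdot> l"
        using ki l' ident_compose[of l] by simp
      also have "\<dots> = k i \<cdot> ((q \<cdot> i) \<cdot> l)"
        using ki l' qi by (intro compose_assoc) (auto simp: cover_iff)
      also have "\<dots> = k i"
        using ql ki compose_ident[of "k i"] by simp
      finally have "h = p \<cdot> (i \<cdot> k i)" using l' s by simp
      then show "h \<in> (\<lambda>i. p \<cdot> (i \<cdot> k i)) ` ?N" using iN by blast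
    qed
  qed
  then show "finite (Hom K g f)" "card (Hom K g f) = card ?N"
    using pullback_deg_sum(1)[OF f g pb] by (auto simp: bij_betw_same_card dest: bij_betw_finite)
qed

text \<open>The components of degree one make up only part of the sum of all component degrees,
  which is \<open>deg K f\<close>.\<close>

lemma Hom_bound:
  assumes f: "cover K f" and g: "cover K g" and "cod K f = cod K g"
  shows "finite (Hom K g f)" "card (Hom K g f) \<le> deg K f"
proof -
  obtain p q where pb: "is_pullback K f g p q" using G1[OF assms] by blast
  let ?N = "{i \<in> Sig K (dom K q). deg K (q \<cdot> i) = 1}"
  show "finite (Hom K g f)" using Hom_card_components[OF f g pb] by simp
  have "card ?N = (\<Sum>i\<in>?N. deg K (q \<cdot> i))" by simp
  also have "\<dots> \<le> deg K f"
    unfolding pullback_deg_sum(2)[OF f g pb]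
    using pullback_deg_sum(1)[OF f g pb] by (intro sum_mono2) auto
  finally show "card (Hom K g f) \<le> deg K f"
    using Hom_card_components[OF f g pb] by simp
qed

section \<open>Counting \<open>Hom\<close> into a composite by fibres\<close>

lemma Hom_bound_Hom:
  assumes "cover K f" "cover K g" "cover K z" "cod K f = dom K g" "w \<in> Hom K z g"
  shows "finite (Hom K w f)" "card (Hom K w f) \<le> deg K f"
  using Hom_bound[of f w] assms Hom_cover[of w z g] HomD[of w z g] by simp_all

text \<open>An arrow \<open>h\<close> into a composite lies in the fibre over
  \<open>w = f \<cdot> h\<close>. As \<open>h\<close> determines \<open>w\<close>, distinct fibres
  are disjoint and the cardinalities add up.\<close>

lemma Hom_compose_eq:
  assumes f: "f \<in> Arr K" and g: "g \<in> Arr K" and fg: "cod K f = dom K g"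
  shows "Hom K z (g \<cdot> f) = (\<Union>w\<in>Hom K z g. Hom K w f)"
proof (intro equalityI subsetI)
  fix h assume "h \<in> Hom K z (g \<cdot> f)"
  note h = HomD[OF this]
  have "f \<cdot> h \<in> Hom K z g" "h \<in> Hom K (f \<cdot> h) f"
    using h f g fg by (auto intro!: HomI simp: compose_Arr dom_compose cod_compose compose_assoc)
  then show "h \<in> (\<Union>w\<in>Hom K z g. Hom K w f)" by blast
next
  fix h assume "h \<in> (\<Union>w\<in>Hom K z g. Hom K w f)"
  then obtain w where w: "w \<in> Hom K z g" "h \<in> Hom K w f" by blast
  note w' = HomD[OF w(1)] HomD[OF w(2)]
  show "h \<in> Hom K z (g \<cdot> f)"
    using w' f g fg by (intro HomI) (simp_all add: dom_compose compose_assoc)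
qed

lemma card_Hom_compose:
  assumes f: "cover K f" and g: "cover K g" and fg: "cod K f = dom K g"
    and z: "cover K z" "cod K z = cod K g"
  shows "card (Hom K z (g \<cdot> f)) = (\<Sum>w\<in>Hom K z g. card (Hom K w f))"
  unfolding Hom_compose_eq[OF cover_ArrD[OF f] cover_ArrD[OF g] fg]
proof (rule card_UN_disjoint)
  show "finite (Hom K z g)" using Hom_bound[OF g z(1)] z by simp
  show "\<forall>w\<in>Hom K z g. finite (Hom K w f)"
    using Hom_bound_Hom[OF f g z(1) fg] by blast
  show "\<forall>w\<in>Hom K z g. \<forall>w'\<in>Hom K z g. w \<noteq> w' \<longrightarrow> Hom K w f \<inter> Hom K w' f = {}"
    by (auto simp: Hom_def)
qed

section \<open>Galois covers and splitting\<close>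

text \<open>From \<open>f = f \<cdot> h\<close> and multiplicativity, \<open>h\<close> has degree
  one and is therefore an isomorphism.\<close>

lemma Aut_eq_Hom:
  assumes f: "cover K f"
  shows "Aut K f = Hom K f f"
proof -
  have "is_iso K h" if h: "h \<in> Hom K f f" for h
  proof -
    have hc: "cover K h" by (rule Hom_cover[OF h f f])
    have "deg K f * deg K h = deg K f"
      using deg_compose[OF hc f] HomD[OF h] by metis
    then have "deg K h = 1" using cover_deg_pos[OF f] by auto
    from deg_one_inverse[OF hc this] show ?thesis
      unfolding is_iso_def using cover_ArrD hc by metis
  qed
  then show ?thesis by (auto simp: Aut_def)
qed

text \<open>Turns being Galois into a cover splitting itself, so that it becomes the case
  \<open>z = g\<close> of the counting statements.\<close>

lemma galois_cover_iff:
  "galois_cover K f \<longleftrightarrow> cover K f \<and> card (Hom K f f) = deg K f"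
  using Hom_bound(1)[of f f] by (auto simp: galois_cover_def Aut_eq_Hom)

text \<open>Write \<open>h = f \<cdot> t\<close>. The \<open>deg K f * deg K t\<close> elements of
  \<open>Hom K h h\<close> are distributed over fibres indexed by \<open>Hom K h f\<close>, each
  with at most \<open>deg K t\<close> elements, so at least \<open>deg K f\<close> fibres are
  needed.\<close>

lemma galois_cover_splits:
  assumes h: "galois_cover K h" and f: "cover K f" and fh: "below K f h"
  shows "card (Hom K h f) = deg K f"
proof -
  have hc: "cover K h" and hh: "card (Hom K h h) = deg K h"
    using h by (simp_all add: galois_cover_iff)
  from fh obtain t where t: "t \<in> Hom K h f" and c: "cod K f = cod K h"
    by (auto simp: below_def)
  note t' = HomD[OF t] and tc = Hom_cover[OF t hc f]
  have "deg K f * deg K t = card (Hom K h (f \<cdot> t))"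
    using deg_compose[OF tc f] t' hh by simp
  also have "\<dots> = (\<Sum>u\<in>Hom K h f. card (Hom K u t))"
    using tc f t' hc c by (intro card_Hom_compose) auto
  also have "\<dots> \<le> card (Hom K h f) * deg K t"
    using sum_bounded_above[OF Hom_bound_Hom(2)[OF tc f hc t'(3)], of "Hom K h f"] by simp
  finally have "deg K f \<le> card (Hom K h f)"
    using cover_deg_pos[OF tc] by simp
  then show ?thesis
    using Hom_bound(2)[OF f hc c] by simp
qed

text \<open>With \<open>w\<close> fixed, each element of \<open>Hom K z f\<close> gives an arrow
  into the pullback, which passes through some component. Hence \<open>deg K f\<close> is at most
  the sum of the \<open>card (Hom K w (q \<cdot> j))\<close>. These are bounded by degrees adding up
  to \<open>deg K f\<close>, so every single bound is attained.\<close>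

lemma component_splits:
  assumes f: "cover K f" and g: "cover K g" and pb: "is_pullback K f g p q"
    and z: "cover K z" and split: "card (Hom K z f) = deg K f"
    and w: "w \<in> Hom K z g" and i: "i \<in> Sig K (dom K q)"
  shows "card (Hom K w (q \<cdot> i)) = deg K (q \<cdot> i)"
proof -
  note P = pullbackD[OF pb] and w' = HomD[OF w] and S = pullback_deg_sum[OF f g pb]
  note wc = Hom_cover[OF w z g]
  have bd: "finite (Hom K w (q \<cdot> j))" "card (Hom K w (q \<cdot> j)) \<le> deg K (q \<cdot> j)"
    if "j \<in> Sig K (dom K q)" for j
    using Hom_bound_Hom[OF _ g z _ w] component_cover[OF g pb that] by auto
  have sub: "Hom K z f \<subseteq> (\<Union>j\<in>Sig K (dom K q). (\<lambda>l. (p \<cdot> j) \<cdot> l) ` Hom K w (q \<cdot> j))"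
  proof
    fix x assume x: "x \<in> Hom K z f"
    note x' = HomD[OF x]
    obtain u where u: "u \<in> Arr K" "dom K u = dom K z" "cod K u = dom K q" "p \<cdot> u = x" "q \<cdot> u = w"
      using pullback_pair[OF pb x'(1) w'(1)] x' w' by metis
    obtain j l where j: "j \<in> Sig K (dom K q)" and l: "l \<in> Hom K u j"
      using Sig_factor[of u] u z by (metis cover_iff)
    note j' = SigD[OF pb j] and l' = HomD[OF l]
    have "(q \<cdot> j) \<cdot> l = w" "x = (p \<cdot> j) \<cdot> l"
      using P j' l' u by (simp_all add: compose_assoc)
    moreover have "l \<in> Hom K w (q \<cdot> j)"
      using P j' l' u w' \<open>(q \<cdot> j) \<cdot> l = w\<close> by (intro HomI) (simp_all add: dom_compose)
    ultimately show "x \<in> (\<Union>j\<in>Sig K (dom K q). (\<lambda>l. (p \<cdot> j) \<cdot> l) ` Hom K w (q \<cdot> j))"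
      using j by blast
  qed
  have "deg K f \<le> card (\<Union>j\<in>Sig K (dom K q). (\<lambda>l. (p \<cdot> j) \<cdot> l) ` Hom K w (q \<cdot> j))"
    unfolding split[symmetric] using S(1) bd by (intro card_mono sub) auto
  also have "\<dots> \<le> (\<Sum>j\<in>Sig K (dom K q). card ((\<lambda>l. (p \<cdot> j) \<cdot> l) ` Hom K w (q \<cdot> j)))"
    using S(1) by (rule card_UN_le)
  also have "\<dots> \<le> (\<Sum>j\<in>Sig K (dom K q). card (Hom K w (q \<cdot> j)))"
    using bd by (intro sum_mono card_image_le)
  finally have le: "(\<Sum>j\<in>Sig K (dom K q). deg K (q \<cdot> j))
      \<le> (\<Sum>j\<in>Sig K (dom K q). card (Hom K w (q \<cdot> j)))"
    using S(2) by simp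
  show ?thesis
  proof (rule ccontr)
    assume "\<not> ?thesis"
    with bd(2)[OF i] have "card (Hom K w (q \<cdot> i)) < deg K (q \<cdot> i)" by simp
    then have "(\<Sum>j\<in>Sig K (dom K q). card (Hom K w (q \<cdot> j)))
        < (\<Sum>j\<in>Sig K (dom K q). deg K (q \<cdot> j))"
      using S(1) bd(2) i by (intro sum_strict_mono_ex1) auto
    with le show False by simp
  qed
qed

section \<open>Effect of one refinement\<close>

text \<open>Precomposition with the epic arrow \<open>q \<cdot> i\<close> embeds the old
  \<open>Hom\<close> into the new one, and \<open>p \<cdot> i\<close> is an additional
  element.\<close>

lemma refine_Hom_card:
  assumes f: "cover K f" and g: "cover K g" and pb: "is_pullback K f g p q"
    and i: "i \<in> Sig K (dom K q)" and d: "deg K (q \<cdot> i) > 1"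
  shows "card (Hom K g f) < card (Hom K (g \<cdot> (q \<cdot> i)) f)"
proof -
  note P = pullbackD[OF pb] and i' = SigD[OF pb i] and qi = component_cover[OF g pb i]
  have fg: "cod K f = cod K g" using pb by (simp add: is_pullback_def)
  let ?g = "g \<cdot> (q \<cdot> i)" and ?T = "\<lambda>h. h \<cdot> (q \<cdot> i)"
  have gc: "cover K ?g" "dom K ?g = dom K i" "cod K ?g = cod K g"
    using qi g by (simp_all add: cover_compose dom_compose cod_compose cover_ArrD)
  have fin: "finite (Hom K ?g f)" using Hom_bound(1)[OF f gc(1)] fg gc by simp
  have inj: "inj_on ?T (Hom K g f)"
    using cover_epic[OF qi(1)] Hom_cover[OF _ g f] qi by (auto intro!: inj_onI simp: HomD)
  have img: "?T ` Hom K g f \<subseteq> Hom K ?g f"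
  proof
    fix y assume "y \<in> ?T ` Hom K g f"
    then obtain h where h: "h \<in> Hom K g f" "y = h \<cdot> (q \<cdot> i)" by blast
    note h' = HomD[OF h(1)]
    show "y \<in> Hom K ?g f"
      unfolding h(2) using h' qi gc f compose_assoc[of "q \<cdot> i" h f]
      by (intro HomI) (simp_all add: compose_Arr dom_compose cod_compose cover_ArrD)
  qed
  have pi: "p \<cdot> i \<in> Hom K ?g f"
  proof (rule HomI)
    have "f \<cdot> (p \<cdot> i) = (f \<cdot> p) \<cdot> i"
      using P(1-5) i' cover_ArrD[OF f] by (simp add: compose_assoc)
    also have "\<dots> = ?g"
      unfolding P(6) using P(1-5) i' cover_ArrD[OF g] by (simp add: compose_assoc)
    finally show "f \<cdot> (p \<cdot> i) = ?g" .
  qed (use P i' gc in \<open>simp_all add: compose_Arr dom_compose cod_compose\<close>)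
  \<comment> \<open>If \<open>p \<cdot> i = h \<cdot> (q \<cdot> i)\<close>, the section
    \<open>s\<close> of \<open>q\<close> belonging to \<open>h\<close> satisfies
    \<open>s \<cdot> (q \<cdot> i) = i\<close>. So \<open>s\<close> passes through the component
    \<open>i\<close> itself, which then has degree one.\<close>
  have "p \<cdot> i \<notin> ?T ` Hom K g f"
  proof
    assume "p \<cdot> i \<in> ?T ` Hom K g f"
    then obtain h where h: "h \<in> Hom K g f" "p \<cdot> i = h \<cdot> (q \<cdot> i)" by blast
    note h' = HomD[OF h(1)]
    let ?I = "ident K (dom K g)"
    have I: "?I \<in> Arr K" "dom K ?I = dom K g" "cod K ?I = dom K g"
      using cover_ArrD[OF g] by (simp_all add: ident_Arr dom_ident cod_ident dom_Obj)
    obtain s where s: "s \<in> Arr K" "dom K s = dom K g" "cod K s = dom K q" "p \<cdot> s = h" "q \<cdot> s = ?I"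
      using pullback_pair[OF pb h'(1) I(1)] h' I g by (metis compose_ident cover_ArrD)
    obtain j l where j: "j \<in> Sig K (dom K q)" and l: "l \<in> Hom K s j"
      using Sig_factor[of s] s g by (metis cover_iff)
    note j' = SigD[OF pb j] and l' = HomD[OF l] and qj = component_cover[OF g pb j]
    note qiA = cover_ArrD[OF qi(1)]
    have "s \<cdot> (q \<cdot> i) = i"
    proof (rule pullback_unique[OF pb])
      show "p \<cdot> (s \<cdot> (q \<cdot> i)) = p \<cdot> i"
        using compose_assoc[of "q \<cdot> i" s p] s P qi qiA h(2) by simp
      show "q \<cdot> (s \<cdot> (q \<cdot> i)) = q \<cdot> i"
        using compose_assoc[of "q \<cdot> i" s q] s P qi qiA ident_compose[of "q \<cdot> i"] by simp
    qed (use s i' qi qiA in \<open>simp_all add: compose_Arr dom_compose cod_compose\<close>)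
    then have "j \<cdot> (l \<cdot> (q \<cdot> i)) = i"
      using compose_assoc[of "q \<cdot> i" l j] l' s j' qi qiA by simp
    then have "l \<cdot> (q \<cdot> i) \<in> Hom K i j"
      using l' s qi qiA by (intro HomI) (simp_all add: compose_Arr dom_compose cod_compose)
    then have "i = j"
      using Sig_unique[of i i j, OF _ _ _ _ ident_in_Hom] i i' j by simp
    have lc: "cover K l" using l' s j' g by (simp add: cover_iff)
    have "(q \<cdot> j) \<cdot> l = ?I" using l' j' P s by (simp add: compose_assoc)
    then have "deg K (q \<cdot> j) * deg K l = 1"
      using deg_compose[OF lc qj(1)] deg_ident[of "dom K g"] g l' qj by (simp add: cover_iff)
    then show False using d \<open>i = j\<close> by simp
  qed
  then have "?T ` Hom K g f \<subset> Hom K ?g f" using img pi by blast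
  then have "card (?T ` Hom K g f) < card (Hom K ?g f)" by (rule psubset_card_mono[OF fin])
  then show ?thesis using card_image[OF inj] by simp
qed

section \<open>The invariant and its consequences\<close>

text \<open>A Galois cover above \<open>f\<close> splits \<open>f\<close> completely, so the last clause forces \<open>g\<close> to lie below
  every Galois cover above \<open>f\<close>; applied to \<open>z = g\<close> it makes \<open>g\<close> Galois once \<open>g\<close> splits \<open>f\<close>.\<close>

definition approximates :: "'a \<Rightarrow> 'a \<Rightarrow> nat \<Rightarrow> bool" where
  "approximates f g n \<longleftrightarrow> cover K g \<and> cod K g = cod K f \<and> 1 \<le> n \<and> n \<le> card (Hom K g f) \<and>
     (\<forall>z. cover K z \<longrightarrow> cod K z = cod K f \<longrightarrow> card (Hom K z f) = deg K f \<longrightarrow>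
        card (Hom K z g) = deg K g)"

lemma approximates_self:
  assumes "cover K f"
  shows "approximates f f 1"
proof -
  have "0 < card (Hom K f f)"
    using Hom_bound(1)[OF assms assms] ident_in_Hom[OF cover_ArrD[OF assms]]
    by (auto simp: card_gt_0_iff)
  then show ?thesis using assms by (simp add: approximates_def)
qed

text \<open>The count of lifts grows strictly, which pays for \<open>n + 1\<close>. For the
  splitting clause, \<open>Hom\<close> into the new cover is counted by fibres over
  \<open>Hom K z g\<close>, and each fibre has exactly \<open>deg K (q \<cdot> i)\<close>
  elements.\<close>

lemma approximates_refine:
  assumes f: "cover K f" and a: "approximates f g n" and pb: "is_pullback K f g p q"
    and i: "i \<in> Sig K (dom K q)" and d: "deg K (q \<cdot> i) > 1"
  shows "approximates f (g \<cdot> (q \<cdot> i)) (n + 1)"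
proof -
  have g: "cover K g" and gf: "cod K g = cod K f" and n: "n \<le> card (Hom K g f)"
    and sp: "\<And>z. \<lbrakk>cover K z; cod K z = cod K f; card (Hom K z f) = deg K f\<rbrakk>
      \<Longrightarrow> card (Hom K z g) = deg K g"
    using a by (auto simp: approximates_def)
  note qi = component_cover[OF g pb i]
  have "card (Hom K z (g \<cdot> (q \<cdot> i))) = deg K (g \<cdot> (q \<cdot> i))"
    if z: "cover K z" "cod K z = cod K f" "card (Hom K z f) = deg K f" for z
  proof -
    have "card (Hom K z (g \<cdot> (q \<cdot> i))) = (\<Sum>w\<in>Hom K z g. card (Hom K w (q \<cdot> i)))"
      using qi g z gf by (intro card_Hom_compose) auto
    also have "\<dots> = (\<Sum>w\<in>Hom K z g. deg K (q \<cdot> i))"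
      by (intro sum.cong refl component_splits[OF f g pb z(1,3) _ i])
    also have "\<dots> = deg K (g \<cdot> (q \<cdot> i))"
      using sp[OF z] deg_compose[OF qi(1) g qi(3)] by simp
    finally show ?thesis .
  qed
  then show ?thesis
    using refine_Hom_card[OF f g pb i d] n qi g gf
    by (simp add: approximates_def cover_compose cod_compose cover_ArrD)
qed

text \<open>The components of degree different from one account for
  \<open>deg K f - card (Hom K g f)\<close>, which is at most 1; but any such component alone
  contributes at least 2, so there are none.\<close>

lemma splits_if_card_ge:
  assumes f: "cover K f" and g: "cover K g" and c: "cod K g = cod K f"
    and n: "deg K f - 1 \<le> card (Hom K g f)"
  shows "card (Hom K g f) = deg K f"
proof -
  obtain p q where pb: "is_pullback K f g p q" using G1[OF f g] c by metis
  note S = pullback_deg_sum[OF f g pb]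
  let ?S = "Sig K (dom K q)"
  let ?N = "{i \<in> ?S. deg K (q \<cdot> i) = 1}"
  have "deg K f = (\<Sum>i\<in>?N. deg K (q \<cdot> i)) + (\<Sum>i\<in>?S - ?N. deg K (q \<cdot> i))"
    unfolding S(2) using S(1) by (subst sum.subset_diff[of ?N]) auto
  also have "(\<Sum>i\<in>?N. deg K (q \<cdot> i)) = card (Hom K g f)"
    using Hom_card_components[OF f g pb] by simp
  finally have eq: "deg K f = card (Hom K g f) + (\<Sum>i\<in>?S - ?N. deg K (q \<cdot> i))" .
  have empty: "?S - ?N = {}"
  proof (rule ccontr)
    assume "?S - ?N \<noteq> {}"
    then obtain i where i: "i \<in> ?S - ?N" by blast
    then have "0 < deg K (q \<cdot> i)" "deg K (q \<cdot> i) \<noteq> 1"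
      using cover_deg_pos[OF component_cover(1)[OF g pb]] by auto
    then have "2 \<le> deg K (q \<cdot> i)" by simp
    also have "\<dots> \<le> (\<Sum>i\<in>?S - ?N. deg K (q \<cdot> i))"
      using i S(1) by (intro member_le_sum) auto
    finally show False using eq n by simp
  qed
  show ?thesis using eq unfolding empty by simp
qed

lemma splits_if_components_deg_one:
  assumes f: "cover K f" and g: "cover K g" and pb: "is_pullback K f g p q"
    and "\<forall>i\<in>Sig K (dom K q). deg K (q \<cdot> i) = 1"
  shows "card (Hom K g f) = deg K f"
proof -
  have "{i \<in> Sig K (dom K q). deg K (q \<cdot> i) = 1} = Sig K (dom K q)" using assms(4) by blast
  then show ?thesis
    using Hom_card_components(2)[OF f g pb] pullback_deg_sum(2)[OF f g pb] assms(4) by simp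
qed

lemma galois_closure_if_splits:
  assumes f: "cover K f" and a: "approximates f g n" and split: "card (Hom K g f) = deg K f"
  shows "galois_closure K f g"
proof -
  have g: "cover K g" "cod K g = cod K f"
    and sp: "\<And>z. \<lbrakk>cover K z; cod K z = cod K f; card (Hom K z f) = deg K f\<rbrakk>
      \<Longrightarrow> card (Hom K z g) = deg K g"
    using a by (auto simp: approximates_def)
  have "galois_cover K g" using sp[OF g split] g by (simp add: galois_cover_iff)
  moreover have "below K f g"
    using cover_deg_pos[OF f] split g by (auto simp: below_def)
  moreover have "below K g h" if h: "galois_cover K h" "below K f h" for h
  proof -
    have "cover K h" "cod K h = cod K f" using h by (auto simp: galois_cover_iff below_def)
    \<comment> \<open>Since \<open>h\<close> splits \<open>g\<close> and \<open>deg K g\<close> is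
      positive, \<open>Hom K h g\<close> is nonempty.\<close>
    from sp[OF this galois_cover_splits[OF h(1) f h(2)]]
    show ?thesis
      using cover_deg_pos[OF g(1)] g \<open>cod K h = cod K f\<close> by (auto simp: below_def)
  qed
  ultimately show ?thesis using g by (auto simp: galois_closure_def minimal_cover_def)
qed

section \<open>Executions: correctness and termination\<close>

text \<open>The bound \<open>n < deg K f\<close>, recorded after the first test, makes the rank drop
  when \<open>n\<close> is increased. The component recorded at \<open>At4\<close> guarantees that
  the choice there is possible.\<close>

fun config_inv :: "'a \<Rightarrow> 'a config \<Rightarrow> bool" where
  "config_inv f (At1 g n) \<longleftrightarrow> approximates f g n"
| "config_inv f (At2 g n) \<longleftrightarrow> approximates f g n \<and> n < deg K f"
| "config_inv f (At3 g n p q) \<longleftrightarrow> approximates f g n \<and> n < deg K f \<and> is_pullback K f g p q"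
| "config_inv f (At4 g n p q) \<longleftrightarrow> approximates f g n \<and> n < deg K f \<and> is_pullback K f g p q \<and>
     (\<exists>i\<in>Sig K (dom K q). deg K (q \<cdot> i) > 1)"
| "config_inv f (At5 g n p q i) \<longleftrightarrow> approximates f g n \<and> n < deg K f \<and> is_pullback K f g p q \<and>
     i \<in> Sig K (dom K q) \<and> deg K (q \<cdot> i) > 1"
| "config_inv f (Output g) \<longleftrightarrow> galois_closure K f g"

text \<open>\<open>PB\<close> is only required to deliver genuine pullbacks, so the lemma applies
  both to \<open>all_pullbacks K\<close> for correctness and to \<open>find_pb T\<close> for
  termination.\<close>

lemma config_inv_step:
  assumes f: "cover K f"
    and PB: "\<And>g p q. \<lbrakk>cover K g; cod K f = cod K g; (p, q) \<in> PB f g\<rbrakk> \<Longrightarrow> is_pullback K f g p q"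
    and step: "alg_step K PB f c c'" and "config_inv f c"
  shows "config_inv f c'"
  using step \<open>config_inv f c\<close>
proof cases
  case (step1_output n g)
  then have a: "approximates f g n" using \<open>config_inv f c\<close> by simp
  \<comment> \<open>The exit test and the invariant give
    \<open>deg K f - 1 \<le> n \<le> card (Hom K g f)\<close>.\<close>
  then have "card (Hom K g f) = deg K f"
    using step1_output by (intro splits_if_card_ge[OF f]) (auto simp: approximates_def)
  then show ?thesis using step1_output galois_closure_if_splits[OF f a] by simp
next
  case (step2 p q g n)
  then show ?thesis using \<open>config_inv f c\<close> PB by (auto simp: approximates_def)
next
  case (step3_output q g n p)
  then have a: "approximates f g n" and "is_pullback K f g p q"
    using \<open>config_inv f c\<close> by simp_all
  moreover from a have "cover K g" by (simp add: approximates_def)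
  ultimately have "card (Hom K g f) = deg K f"
    using step3_output by (intro splits_if_components_deg_one[OF f]) auto
  then show ?thesis using step3_output galois_closure_if_splits[OF f a] by simp
next
  case (step3_else q g n p)
  then obtain i where i: "i \<in> Sig K (dom K q)" "deg K (q \<cdot> i) \<noteq> 1" by blast
  have "cover K g" "is_pullback K f g p q"
    using step3_else \<open>config_inv f c\<close> by (simp_all add: approximates_def)
  then have "0 < deg K (q \<cdot> i)"
    using i by (intro cover_deg_pos component_cover)
  then have "deg K (q \<cdot> i) > 1" using i by simp
  then show ?thesis using step3_else \<open>config_inv f c\<close> i by auto
next
  case (step5 g n p q i)
  then show ?thesis using \<open>config_inv f c\<close> approximates_refine[OF f, of g n p q i] by simp
qed auto

lemma config_inv_reachable:
  assumes f: "cover K f"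
    and PB: "\<And>g p q. \<lbrakk>cover K g; cod K f = cod K g; (p, q) \<in> PB f g\<rbrakk> \<Longrightarrow> is_pullback K f g p q"
    and "(alg_step K PB f)\<^sup>*\<^sup>* (alg_start f) c"
  shows "config_inv f c"
  using assms(3)
proof induction
  case base
  then show ?case using approximates_self[OF f] by (simp add: alg_start_def)
next
  case (step c c')
  then show ?case using config_inv_step[OF f PB] by blast
qed

lemma algorithm_correct:
  assumes f: "cover K f" and "alg_output K (all_pullbacks K) f g"
  shows "galois_closure K f g"
proof -
  have "config_inv f (Output g)"
    by (rule config_inv_reachable[OF f, where PB = "all_pullbacks K"])
      (use assms(2) in \<open>auto simp: all_pullbacks_def alg_output_def\<close>)
  then show ?thesis by simp
qed

text \<open>A round of the loop has five steps. Each of the first four lowers the offset by one; the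
  return to \<open>At1\<close> raises it by 4, while the increased \<open>n\<close> lowers the main
  term by 5.\<close>

fun config_rank :: "'a \<Rightarrow> 'a config \<Rightarrow> nat" where
  "config_rank f (At1 g n) = 5 * (deg K f - n) + 5"
| "config_rank f (At2 g n) = 5 * (deg K f - n) + 4"
| "config_rank f (At3 g n p q) = 5 * (deg K f - n) + 3"
| "config_rank f (At4 g n p q) = 5 * (deg K f - n) + 2"
| "config_rank f (At5 g n p q i) = 5 * (deg K f - n) + 1"
| "config_rank f (Output g) = 0"

lemma config_rank_step:
  assumes "alg_step K PB f c c'" "config_inv f c"
  shows "config_rank f c' < config_rank f c"
  using assms by cases auto

text \<open>The invariant ensures that the subroutines are called only on covers and on domains of
  pullback projections, where their times are assumed finite.\<close>

lemma step_time_finite: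
  assumes T: "pullbacks_in_finite_time K T" "Sig_in_finite_time K T" "deg_in_finite_time K T"
    and f: "cover K f" and step: "alg_step K (find_pb T) f c c'" and "config_inv f c"
  shows "step_time K T f c c' < \<infinity>"
proof -
  have degT: "\<And>h. cover K h \<Longrightarrow> deg_time T h \<noteq> \<infinity>"
    using T(3) by (auto simp: deg_in_finite_time_def)
  have at3: "(\<Sum>i\<in>Sig K (dom K q). deg_time T (q \<cdot> i)) + 1 < \<infinity>"
    if "approximates f g n" "is_pullback K f g p q" for g n p q
  proof -
    have "cover K g" using that by (simp add: approximates_def)
    then have "(\<Sum>i\<in>Sig K (dom K q). deg_time T (q \<cdot> i)) < \<infinity>"
      using degT component_cover(1)[OF _ that(2)] by (intro sum_enat_finite) auto
    then show ?thesis by (simp add: plus_eq_infty_iff_enat)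
  qed
  show ?thesis
    using step
  proof cases
    case (step2 p q g n)
    then have g: "cover K g" "cod K f = cod K g"
      using \<open>config_inv f c\<close> by (auto simp: approximates_def)
    then have "is_pullback K f g p q \<and> pb_time T f g (p, q) < \<infinity>"
      using T(1) f step2(3) by (fastforce simp: pullbacks_in_finite_time_def)
    moreover from this have "Sig_time T (dom K q) < \<infinity>"
      using T(2) pullbackD(2) dom_Obj by (auto simp: Sig_in_finite_time_def)
    ultimately show ?thesis using step2 by (simp add: plus_eq_infty_iff_enat)
  qed (use \<open>config_inv f c\<close> degT[OF f] at3 in \<open>auto simp: plus_eq_infty_iff_enat\<close>)
qed

lemma algorithm_terminates:
  assumes T: "pullbacks_in_finite_time K T" "Sig_in_finite_time K T" "deg_in_finite_time K T"
    and f: "cover K f"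
  shows "alg_terminates K T f"
proof -
  have PB: "is_pullback K f g p q"
    if "cover K g" "cod K f = cod K g" "(p, q) \<in> find_pb T f g" for g p q
    using T(1) f that by (fastforce simp: pullbacks_in_finite_time_def)
  have reach: "config_inv f c" if "(alg_step K (find_pb T) f)\<^sup>*\<^sup>* (alg_start f) c" for c
    by (rule config_inv_reachable[OF f PB that])
  \<comment> \<open>Phrased for finite prefixes, so that it covers initial parts of an infinite run
    as well as the runs whose total time is bounded.\<close>
  have inv: "config_inv f (r k)"
    if "r 0 = alg_start f" "\<forall>j<N. alg_step K (find_pb T) f (r j) (r (Suc j))" "k \<le> N" for r k N
  proof (rule reach)
    show "(alg_step K (find_pb T) f)\<^sup>*\<^sup>* (alg_start f) (r k)"
      using that(3) by (induction k) (use that in \<open>auto intro: rtranclp.rtrancl_into_rtrancl\<close>)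
  qed
  have no_inf: False
    if r: "r 0 = alg_start f" "\<forall>k. alg_step K (find_pb T) f (r k) (r (Suc k))" for r
  proof -
    have "(r (Suc k), r k) \<in> measure (config_rank f)" for k
      using config_rank_step inv[of r k k] r unfolding in_measure by blast
    then show False
      using wf_measure[of "config_rank f"] by (auto simp: wf_iff_no_infinite_down_chain)
  qed
  have progress: "(\<exists>c'. alg_step K (find_pb T) f c c') \<or> (\<exists>g. c = Output g)"
    if run: "(alg_step K (find_pb T) f)\<^sup>*\<^sup>* (alg_start f) c" for c
  proof (cases c)
    case (At1 g n)
    then show ?thesis
      using alg_step.step1_output[of K f n "find_pb T" g] alg_step.step1_else[of K f n "find_pb T" g]
      by blast
  next
    case (At2 g n)
    then have "cover K g" "cod K f = cod K g"
      using reach[OF run] by (auto simp: approximates_def)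
    then have "find_pb T f g \<noteq> {}"
      using T(1) f by (simp add: pullbacks_in_finite_time_def)
    then show ?thesis using At2 alg_step.step2 by fast
  next
    case (At3 g n p q)
    then show ?thesis
      using alg_step.step3_output[of K q "find_pb T" f g n p]
        alg_step.step3_else[of K q "find_pb T" f g n p] by blast
  next
    case (At4 g n p q)
    then obtain i where "i \<in> Sig K (dom K q)" "deg K (q \<cdot> i) > 1"
      using reach[OF run] by auto
    then show ?thesis using At4 alg_step.step4 by metis
  next
    case (At5 g n p q i)
    then show ?thesis using At5 alg_step.step5[of K "find_pb T" f g n p q i] by blast
  qed simp
  have "(\<Sum>k<N. step_time K T f (r k) (r (Suc k))) < \<infinity>"
    if "r 0 = alg_start f" "\<forall>k<N. alg_step K (find_pb T) f (r k) (r (Suc k))" for r N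
    using that inv[OF that] by (intro sum_enat_finite step_time_finite[OF T f]) auto
  with no_inf progress show ?thesis unfolding alg_terminates_def by blast
qed

end

theorem theorem4p5:
  fixes K :: "('o, 'a) galois_cat"
  assumes "galois_category K"
  shows "(\<forall>T :: ('o, 'a) subroutines.
            pullbacks_in_finite_time K T \<and> Sig_in_finite_time K T \<and> deg_in_finite_time K T \<longrightarrow>
            (\<forall>f. cover K f \<longrightarrow> alg_terminates K T f)) \<and>
         (\<forall>f g. cover K f \<and> alg_output K (all_pullbacks K) f g \<longrightarrow> galois_closure K f g)"
  using galois_category.algorithm_terminates[OF assms]
    galois_category.algorithm_correct[OF assms] by blast

end
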